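(* Fix one of the five cases below. Two bounding pairs $(g,V),(g',V')\in BP_n$ are conjugate under $G_\infty(\mathbb{F}_q)$ if and only if they are conjugate under the subgroup $G_{B_n}(V_n)$.
   Context: Five cases of a standard form $B_n$ on $V_n$: (Hermitian) $V_n=\mathbb{F}_{q^2}^n$, $B_n(x,y)=\sum_{i=1}^nx_iy_i^q$; (alternating) $V_n=\mathbb{F}_q^{2n}$, $B_n=\sum_{i=1}^n(x_{2i-1}y_{2i}-x_{2i}y_{2i-1})$; and, for $q$ odd, (positive symmetric) $V_n=\mathbb{F}_q^{2n}$, $B_n=\sum_{i=1}^n(x_{2i-1}y_{2i}+x_{2i}y_{2i-1})$; (negative symmetric) $V_n=\mathbb{F}_q^{2n}$, $B_n=x_1y_1-\epsilon x_2y_2+\sum_{i=2}^n(x_{2i-1}y_{2i}+x_{2i}y_{2i-1})$ with $\epsilon$ a fixed non-square; (odd symmetric) $V_n=\mathbb{F}_q^{2n+1}$, $B_n=x_1y_1+\sum_{i=1}^n(x_{2i}y_{2i+1}+x_{2i+1}y_{2i})$. $V_n\subset V_{n+1}$ as the initial coordinates, $V_\infty=\varinjlim V_n$ with the induced form $B_\infty$, and $V_n^\perp$ is the orthogonal complement of $V_n$ in $V_\infty$ (spanned by the remaining basis vectors). $G_{B_n}(V_n)$ is the symmetry group $\{g\in GL(V_n):B_n(gv,gw)=B_n(v,w)\}$, viewed inside $G_{B_{n+1}}(V_{n+1})$ by acting as the identity on the new coordinates, and $G_\infty(\mathbb{F}_q)=\varinjlim G_{B_n}(V_n)$. A subspace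 of $V_\infty$ is smooth if it contains $V_n^\perp$ for some $n$. A bounding pair is $(g,V)$ with $g\in G_\infty(\mathbb{F}_q)$ and $V$ a smooth subspace fixed pointwise by $g$; $BP_n$ is the set of bounding pairs with $V\supseteq V_n^\perp$. $G_\infty(\mathbb{F}_q)$ acts by $x\cdot(g,V)=(xgx^{-1},xV)$. *)

theory Defs
  imports Main
begin

text \<open>The five cases of standard forms. Vectors of V_infinity are modelled as
  finitely supported functions nat => 'a; coordinate x_{i+1} of the paper is x i here.\<close>

datatype form_case = Herm | Alt | PosSym | NegSym | OddSym

definition setting_ok :: "form_case \<Rightarrow> nat \<Rightarrow> 'a::{field,finite} \<Rightarrow> bool" where
  "setting_ok c q eps \<longleftrightarrow>
     (c = Herm \<longrightarrow> card (UNIV :: 'a set) = q ^ 2) \<and>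
     (c \<noteq> Herm \<longrightarrow> card (UNIV :: 'a set) = q) \<and>
     (c \<in> {PosSym, NegSym, OddSym} \<longrightarrow> odd q) \<and>
     (c = NegSym \<longrightarrow> \<not> (\<exists>a. a * a = eps))"

fun dimV :: "form_case \<Rightarrow> nat \<Rightarrow> nat" where
  "dimV Herm n = n"
| "dimV OddSym n = 2 * n + 1"
| "dimV _ n = 2 * n"

fun formB :: "form_case \<Rightarrow> nat \<Rightarrow> 'a::{field,finite} \<Rightarrow> nat \<Rightarrow> (nat \<Rightarrow> 'a) \<Rightarrow> (nat \<Rightarrow> 'a) \<Rightarrow> 'a" where
  "formB Herm q eps n x y = (\<Sum>i<n. x i * y i ^ q)"
| "formB Alt q eps n x y = (\<Sum>i<n. x (2*i) * y (2*i+1) - x (2*i+1) * y (2*i))"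
| "formB PosSym q eps n x y = (\<Sum>i<n. x (2*i) * y (2*i+1) + x (2*i+1) * y (2*i))"
| "formB NegSym q eps n x y = x 0 * y 0 - eps * x 1 * y 1
      + (\<Sum>i\<in>{1..<n}. x (2*i) * y (2*i+1) + x (2*i+1) * y (2*i))"
| "formB OddSym q eps n x y = x 0 * y 0
      + (\<Sum>i<n. x (2*i+1) * y (2*i+2) + x (2*i+2) * y (2*i+1))"

definition vadd :: "(nat \<Rightarrow> 'a::field) \<Rightarrow> (nat \<Rightarrow> 'a) \<Rightarrow> nat \<Rightarrow> 'a" where
  "vadd x y = (\<lambda>i. x i + y i)"

definition vscale :: "'a::field \<Rightarrow> (nat \<Rightarrow> 'a) \<Rightarrow> nat \<Rightarrow> 'a" where
  "vscale a x = (\<lambda>i. a * x i)"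

definition Vinf :: "(nat \<Rightarrow> 'a::field) set" where
  "Vinf = {x. finite {i. x i \<noteq> 0}}"

definition Vn :: "form_case \<Rightarrow> nat \<Rightarrow> (nat \<Rightarrow> 'a::field) set" where
  "Vn c n = {x. \<forall>i\<ge>dimV c n. x i = 0}"

definition Vperp :: "form_case \<Rightarrow> nat \<Rightarrow> (nat \<Rightarrow> 'a::field) set" where
  "Vperp c n = {x \<in> Vinf. \<forall>i<dimV c n. x i = 0}"

definition projV :: "form_case \<Rightarrow> nat \<Rightarrow> (nat \<Rightarrow> 'a::field) \<Rightarrow> nat \<Rightarrow> 'a" where
  "projV c n x = (\<lambda>i. if i < dimV c n then x i else 0)"

text \<open>G_{B_n}(V_n), embedded into the maps of V_infinity by acting as the identity on the
  remaining coordinates.\<close>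
definition Gn :: "form_case \<Rightarrow> nat \<Rightarrow> 'a::{field,finite} \<Rightarrow> nat \<Rightarrow> ((nat \<Rightarrow> 'a) \<Rightarrow> (nat \<Rightarrow> 'a)) set" where
  "Gn c q eps n = {g.
     bij_betw g (Vn c n) (Vn c n) \<and>
     (\<forall>x\<in>Vn c n. \<forall>y\<in>Vn c n. g (vadd x y) = vadd (g x) (g y)) \<and>
     (\<forall>a. \<forall>x\<in>Vn c n. g (vscale a x) = vscale a (g x)) \<and>
     (\<forall>x\<in>Vn c n. \<forall>y\<in>Vn c n. formB c q eps n (g x) (g y) = formB c q eps n x y) \<and>
     (\<forall>x. g x = (\<lambda>i. if i < dimV c n then g (projV c n x) i else x i))}"

definition Ginf :: "form_case \<Rightarrow> nat \<Rightarrow> 'a::{field,finite} \<Rightarrow> ((nat \<Rightarrow> 'a) \<Rightarrow> (nat \<Rightarrow> 'a)) set" where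
  "Ginf c q eps = (\<Union>n. Gn c q eps n)"

definition is_subspace :: "(nat \<Rightarrow> 'a::field) set \<Rightarrow> bool" where
  "is_subspace V \<longleftrightarrow> V \<subseteq> Vinf \<and> (\<lambda>i. 0) \<in> V \<and>
     (\<forall>x\<in>V. \<forall>y\<in>V. vadd x y \<in> V) \<and> (\<forall>a. \<forall>x\<in>V. vscale a x \<in> V)"

definition smooth :: "form_case \<Rightarrow> (nat \<Rightarrow> 'a::field) set \<Rightarrow> bool" where
  "smooth c V \<longleftrightarrow> is_subspace V \<and> (\<exists>n. Vperp c n \<subseteq> V)"

definition bounding_pair :: "form_case \<Rightarrow> nat \<Rightarrow> 'a::{field,finite} \<Rightarrow>
    ((nat \<Rightarrow> 'a) \<Rightarrow> (nat \<Rightarrow> 'a)) \<Rightarrow> (nat \<Rightarrow> 'a) set \<Rightarrow> bool" where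
  "bounding_pair c q eps g V \<longleftrightarrow> g \<in> Ginf c q eps \<and> smooth c V \<and> (\<forall>v\<in>V. g v = v)"

definition BP :: "form_case \<Rightarrow> nat \<Rightarrow> 'a::{field,finite} \<Rightarrow> nat \<Rightarrow>
    (((nat \<Rightarrow> 'a) \<Rightarrow> (nat \<Rightarrow> 'a)) \<times> (nat \<Rightarrow> 'a) set) set" where
  "BP c q eps n = {(g, V). bounding_pair c q eps g V \<and> Vperp c n \<subseteq> V}"

definition act :: "((nat \<Rightarrow> 'a) \<Rightarrow> (nat \<Rightarrow> 'a)) \<Rightarrow>
    ((nat \<Rightarrow> 'a) \<Rightarrow> (nat \<Rightarrow> 'a)) \<times> (nat \<Rightarrow> 'a) set \<Rightarrow>
    ((nat \<Rightarrow> 'a) \<Rightarrow> (nat \<Rightarrow> 'a)) \<times> (nat \<Rightarrow> 'a) set" where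
  "act x p = (x \<circ> fst p \<circ> inv x, x ` snd p)"

definition conj_under where
  "conj_under H p p' \<longleftrightarrow> (\<exists>x\<in>H. act x p = p')"

end

theory Submission
  imports Defs "HOL-Computational_Algebra.Polynomial" "HOL-Algebra.Sylow" "HOL-Algebra.Multiplicative_Group"
begin

text \<open>The conjugating element is moved down from \<open>Gn (m + 1)\<close> to \<open>Gn m\<close>, one step at a time, for
  \<open>m \<ge> n\<close>. Let \<open>x \<in> Gn (m + 1)\<close> conjugate \<open>(g, V)\<close> to \<open>(g', V')\<close> and let \<open>e\<close> be one of the basis vectors of
  the block by which \<open>Vn (m + 1)\<close> exceeds \<open>Vn m\<close>. Since \<open>V\<close> and \<open>V'\<close> contain \<open>Vperp m\<close>, both \<open>e\<close> and \<open>f = x e\<close> lie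
  in \<open>V'\<close>, so any transvection or reflection along \<open>u = f - e\<close> preserves \<open>V'\<close>, and it commutes with \<open>g'\<close>
  because \<open>g'\<close> is an isometry fixing \<open>u\<close>: it stabilises \<open>(g', V')\<close>. Composing \<open>x\<close> with such maps, possibly
  going through an intermediate vector of \<open>V'\<close> when \<open>B f u = 0\<close>, makes it fix the block pointwise. It then
  preserves the orthogonal complement of the block and so belongs to \<open>Gn m\<close>. In this way Witt's theorem
  is not needed.\<close>

section \<open>Finite fields\<close>

text \<open>Multiplication by a nonzero \<open>x\<close> permutes the nonzero elements, so it leaves
  their product unchanged while also multiplying it by \<open>x ^ card U\<close>.\<close>

lemma finite_field_power_card:
  fixes x :: "'a::{field,finite}"
  shows "x ^ card (UNIV :: 'a set) = x"
proof (cases "x = 0")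
  case True
  then show ?thesis by (simp add: zero_power finite_UNIV_card_ge_0)
next
  case False
  define U where "U = UNIV - {0::'a}"
  have "bij_betw ((*) x) U U"
    by (rule bij_betwI[where g = "\<lambda>y. y / x"]) (use False in \<open>auto simp: U_def\<close>)
  then have "\<Prod>U = (\<Prod>y\<in>U. x * y)"
    by (simp add: prod.reindex_bij_betw[where g = "\<lambda>y. y"])
  then have "\<Prod>U = x ^ card U * \<Prod>U"
    by (simp add: prod.distrib)
  moreover have "\<Prod>U \<noteq> 0"
    by (simp add: U_def)
  ultimately have "x ^ card U = 1"
    by simp
  moreover have "card (UNIV :: 'a set) = Suc (card U)"
    unfolding U_def by (rule card_Suc_Diff1[symmetric]) simp_all
  ultimately show ?thesis
    by simp
qed

lemma prime_CHAR_finite_field: "prime CHAR('a::{field,finite})"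
  by (rule prime_CHAR_semidom) (simp add: finite_imp_CHAR_pos)

text \<open>Sylow's theorem, applied to the additive group, gives a subgroup of order
  \<open>r\<close>. A nonzero \<open>x\<close> in it satisfies \<open>of_nat r * x = 0\<close>, so
  the characteristic divides the prime \<open>r\<close>.\<close>

lemma prime_dvd_card_field:
  assumes "prime r" "r dvd card (UNIV :: 'a::{field,finite} set)"
  shows "r = CHAR('a)"
proof -
  define G :: "'a monoid" where "G = \<lparr>carrier = UNIV, monoid.mult = (+), one = 0\<rparr>"
  interpret G: group G
    by (rule groupI) (auto simp: G_def add.assoc intro: exI[of _ "- _"] left_minus)
  have pow: "x [^]\<^bsub>G\<^esub> n = of_nat n * x" for x :: 'a and n :: nat
    by (induction n) (simp_all add: G_def nat_pow_def algebra_simps)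
  obtain m where m: "card (UNIV :: 'a set) = r * m"
    using assms(2) by blast
  obtain H where H: "subgroup H G" "card H = r"
    using sylow_thm[OF assms(1) G.is_group, of 1 m] m by (auto simp: order_def G_def)
  have "\<not> H \<subseteq> {0}"
    using H(2) prime_ge_2_nat[OF assms(1)] card_mono[of "{0}" H] by force
  then obtain x where x: "x \<in> H" "x \<noteq> 0"
    by blast
  interpret H: group "G\<lparr>carrier := H\<rparr>"
    using H(1) G.is_group by (rule subgroup.subgroup_is_group)
  have "x [^]\<^bsub>G\<lparr>carrier := H\<rparr>\<^esub> order (G\<lparr>carrier := H\<rparr>) = \<one>\<^bsub>G\<lparr>carrier := H\<rparr>\<^esub>"
    using x(1) by (intro H.pow_order_eq_1) simp
  then have "of_nat r * x = 0"
    using pow[of x r] H(2) by (simp add: order_def nat_pow_def G_def)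
  then have "CHAR('a) dvd r"
    using x(2) by (simp add: of_nat_eq_0_iff_char_dvd)
  then show ?thesis
    using assms(1) prime_CHAR_finite_field[where 'a='a] primes_dvd_imp_eq by metis
qed

lemma two_neq_zero_of_odd_card:
  assumes "odd (card (UNIV :: 'a::{field,finite} set))"
  shows "(2::'a) \<noteq> 0"
proof
  assume "(2::'a) = 0"
  then have "CHAR('a) dvd 2"
    using of_nat_eq_0_iff_char_dvd[where 'a = 'a, of 2] by simp
  then have c: "CHAR('a) = 2"
    using prime_CHAR_finite_field[where 'a='a] two_is_prime_nat primes_dvd_imp_eq by blast
  have "card {0::'a, 1} \<le> card (UNIV :: 'a set)"
    by (intro card_mono) auto
  then have "card (UNIV :: 'a set) \<noteq> 1"
    by simp
  then obtain r where "prime r" "r dvd card (UNIV :: 'a set)"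
    using prime_factor_nat by blast
  with prime_dvd_card_field[OF this] c assms show False
    by simp
qed

lemma power_CHAR_power_add:
  fixes x y :: "'a::{field,finite}"
  shows "(x + y) ^ (CHAR('a) ^ k) = x ^ (CHAR('a) ^ k) + y ^ (CHAR('a) ^ k)"
proof (induction k)
  case (Suc k)
  have frob: "(u + v) ^ CHAR('a) = u ^ CHAR('a) + v ^ CHAR('a)" for u v :: 'a
  proof -
    define p where "p = CHAR('a)"
    have p: "prime p"
      unfolding p_def by (rule prime_CHAR_finite_field)
    have z: "(of_nat (p choose i) :: 'a) = 0" if "i \<in> {1..<p}" for i
      using dvd_choose_prime[of i p] that p unfolding of_nat_eq_0_iff_char_dvd p_def by auto
    have "(u + v) ^ p = (\<Sum>i\<le>p. of_nat (p choose i) * u ^ i * v ^ (p - i))"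
      by (rule binomial_ring)
    also have "\<dots> = (\<Sum>i\<in>{0,p}. of_nat (p choose i) * u ^ i * v ^ (p - i))"
      by (intro sum.mono_neutral_right) (auto simp: z Suc_le_eq)
    also have "\<dots> = u ^ p + v ^ p"
      using prime_gt_0_nat[OF p] by simp
    finally show ?thesis
      by (simp add: p_def)
  qed
  show ?case
    by (simp add: power_Suc2 power_mult Suc.IH frob del: power_Suc)
qed simp

text \<open>Every prime factor of \<open>q\<close> divides the order of the field and hence is the
  characteristic. So \<open>q\<close> is a power of it, and \<open>x ^ q\<close> is an iterate of
  the Frobenius map.\<close>

lemma sqrt_card_power_add:
  fixes x y :: "'a::{field,finite}"
  assumes "card (UNIV :: 'a set) = q ^ 2"
  shows "(x + y) ^ q = x ^ q + y ^ q"
proof -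
  have "q \<noteq> 0"
    using assms finite_UNIV_card_ge_0[where 'a='a] by (auto intro: ccontr)
  moreover have "r = CHAR('a)" if "prime r" "r dvd q" for r
    using that assms prime_dvd_card_field[of r, where 'a = 'a] by (simp add: power2_eq_square)
  ultimately have "multiplicity r q = 0" if "prime r" "r \<noteq> CHAR('a)" for r
    using that by (metis not_dvd_imp_multiplicity_0)
  then have "prime_factorization q = replicate_mset (multiplicity CHAR('a) q) CHAR('a)"
    using prime_CHAR_finite_field[where 'a='a]
    by (intro multiset_eqI) (simp add: count_prime_factorization)
  then have "q = CHAR('a) ^ multiplicity CHAR('a) q"
    using prod_mset_prime_factorization_nat[of q] \<open>q \<noteq> 0\<close> by simp
  then show ?thesis
    using power_CHAR_power_add[of x y "multiplicity CHAR('a) q"] by simp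
qed

text \<open>The polynomial \<open>X^q - X\<close> has at most \<open>q < q^2\<close> roots, so some
  \<open>a\<close> has \<open>a ^ q \<noteq> a\<close>. As the \<open>q\<close>-th power map is an
  involution, \<open>a ^ q / a\<close> has norm 1. In the Hermitian case this scalar plays the part
  that -1 plays for symmetric forms.\<close>

lemma exists_norm_one:
  fixes q :: nat
  assumes "card (UNIV :: 'a::{field,finite} set) = q ^ 2"
  shows "\<exists>l::'a. l \<noteq> 1 \<and> l * l ^ q = 1"
proof -
  have "card {0::'a, 1} \<le> card (UNIV :: 'a set)"
    by (intro card_mono) auto
  then have q2: "q \<ge> 2"
    using assms by (cases "q = 0 \<or> q = 1") auto
  define P :: "'a poly" where "P = Polynomial.monom 1 q - Polynomial.monom 1 1"
  have deg: "degree P = q"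
    using q2 degree_add_eq_left[of "- Polynomial.monom (1::'a) 1" "Polynomial.monom 1 q"]
    by (simp add: P_def degree_monom_eq)
  then have "P \<noteq> 0"
    using q2 by auto
  then have "card {x. poly P x = 0} \<le> q"
    using card_poly_roots_bound[of P] deg by simp
  also have "q < q ^ 2"
    using q2 by (simp add: power2_eq_square)
  finally have "{x. poly P x = 0} \<noteq> UNIV"
    using assms by auto
  then obtain a :: 'a where a: "a ^ q \<noteq> a"
    by (auto simp: P_def poly_monom)
  then have "a \<noteq> 0"
    using q2 by (auto simp: zero_power)
  moreover have "(a ^ q) ^ q = a"
    using finite_field_power_card[of a] assms by (simp add: power2_eq_square power_mult)
  ultimately show ?thesis
    using a by (intro exI[of _ "a ^ q / a"]) (simp add: power_divide)
qed

section \<open>Isometries and transvections\<close>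

definition linear_map :: "((nat \<Rightarrow> 'a::field) \<Rightarrow> (nat \<Rightarrow> 'a)) \<Rightarrow> bool" where
  "linear_map g \<longleftrightarrow> (\<forall>x y. g (vadd x y) = vadd (g x) (g y)) \<and> (\<forall>a x. g (vscale a x) = vscale a (g x))"

text \<open>Elements of \<open>Gn\<close> act on all functions, not only on those of finite support, so the
  isometries are described on the whole function space.\<close>

definition isometries ::
    "nat \<Rightarrow> ((nat \<Rightarrow> 'a::field) \<Rightarrow> (nat \<Rightarrow> 'a) \<Rightarrow> 'a) \<Rightarrow> ((nat \<Rightarrow> 'a) \<Rightarrow> (nat \<Rightarrow> 'a)) set" where
  "isometries d B = {g. linear_map g \<and> bij g \<and> (\<forall>x. \<forall>i\<ge>d. g x i = x i) \<and>
     (\<forall>x. (\<forall>i<d. x i = 0) \<longrightarrow> g x = x) \<and> (\<forall>x y. B (g x) (g y) = B x y)}"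

lemma isometriesD:
  assumes "g \<in> isometries d B"
  shows "g (vadd x y) = vadd (g x) (g y)" "g (vscale a x) = vscale a (g x)" "bij g"
    "d \<le> i \<Longrightarrow> g x i = x i" "(\<And>i. i < d \<Longrightarrow> x i = 0) \<Longrightarrow> g x = x" "B (g x) (g y) = B x y"
  using assms by (auto simp: isometries_def linear_map_def)

lemma isometries_comp:
  assumes "g \<in> isometries d B" "h \<in> isometries d B"
  shows "g \<circ> h \<in> isometries d B"
  using assms by (auto simp: isometries_def linear_map_def bij_comp)

text \<open>With \<open>\<sigma>\<close> the identity this covers symmetric (\<open>\<delta> = 1\<close>) and alternating (\<open>\<delta> = -1\<close>) forms.\<close>

locale hermitian_form =
  fixes \<sigma> :: "'a::field \<Rightarrow> 'a" and \<delta> :: 'a and B :: "(nat \<Rightarrow> 'a) \<Rightarrow> (nat \<Rightarrow> 'a) \<Rightarrow> 'a" and d :: nat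
  assumes conj_add: "\<sigma> (a + b) = \<sigma> a + \<sigma> b"
    and conj_mult: "\<sigma> (a * b) = \<sigma> a * \<sigma> b"
    and conj_conj: "\<sigma> (\<sigma> a) = a"
    and sign: "\<delta> = 1 \<or> \<delta> = -1"
    and add_left: "B (vadd x y) z = B x z + B y z"
    and scale_left: "B (vscale a x) z = a * B x z"
    and swap: "B y x = \<delta> * \<sigma> (B x y)"
    and zero_left: "(\<And>i. i < d \<Longrightarrow> x i = 0) \<Longrightarrow> B x y = 0"
begin

lemma conj_0 [simp]: "\<sigma> 0 = 0"
  using conj_add[of 0 0] by (metis add_0 add_cancel_right_right)

lemma conj_minus [simp]: "\<sigma> (- a) = - \<sigma> a"
  using conj_add[of a "- a"] by (simp add: add_eq_0_iff)

lemma conj_eq_0 [simp]: "\<sigma> a = 0 \<longleftrightarrow> a = 0"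
  by (metis conj_0 conj_conj)

lemma conj_1 [simp]: "\<sigma> 1 = 1"
  using conj_mult[of 1 1] by simp

lemma conj_sign [simp]: "\<sigma> \<delta> = \<delta>"
  using sign by auto

lemma sign_sign [simp]: "\<delta> * \<delta> = 1" "\<delta> * (\<delta> * a) = a" "\<delta> \<noteq> 0"
  using sign by auto

lemma conj_divide: "\<sigma> (a / b) = \<sigma> a / \<sigma> b"
proof (cases "b = 0")
  case False
  then have "\<sigma> (a / b) * \<sigma> b = \<sigma> a"
    by (simp flip: conj_mult)
  then show ?thesis
    using False by (simp add: field_simps)
qed simp

lemma add_right: "B z (vadd x y) = B z x + B z y"
  using swap[of z x] swap[of z y] swap[of z "vadd x y"] by (simp add: add_left conj_add algebra_simps)

lemma scale_right: "B z (vscale a x) = \<sigma> a * B z x"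
  using swap[of z x] swap[of z "vscale a x"] by (simp add: scale_left conj_mult)

lemmas form_simps = add_left add_right scale_left scale_right

text \<open>If \<open>B f f = B e e\<close>, \<open>u = f - e\<close> and \<open>b = B f u \<noteq> 0\<close>, then \<open>transv u b\<close> sends \<open>f\<close> to \<open>e\<close>, and
  \<open>B u u = b + \<delta> * \<sigma> b\<close>, which is exactly the condition for \<open>transv u b\<close> to be an isometry. It is a
  (quasi-)reflection or a transvection according to the type of the form.\<close>

definition transv :: "(nat \<Rightarrow> 'a) \<Rightarrow> 'a \<Rightarrow> (nat \<Rightarrow> 'a) \<Rightarrow> (nat \<Rightarrow> 'a)" where
  "transv u b v = vadd v (vscale (- (B v u / b)) u)"

text \<open>Expanding, every correction to \<open>B v w\<close> is a multiple of
  \<open>B v u * \<sigma> (B w u)\<close>. The two linear ones have coefficients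
  \<open>- \<delta> / b\<close> and \<open>- 1 / \<sigma> b\<close>; the quadratic one has
  \<open>B u u / (b * \<sigma> b)\<close>, which is the negative of their sum.\<close>

lemma transv_isometry:
  assumes "b \<noteq> 0" "B u u = b + \<delta> * \<sigma> b"
  shows "B (transv u b v) (transv u b w) = B v w"
proof -
  define b' where "b' = \<sigma> b"
  have "b' \<noteq> 0"
    using assms(1) by (simp add: b'_def)
  moreover have "B u w = \<delta> * \<sigma> (B w u)"
    by (rule swap)
  ultimately show ?thesis
    using assms(1) unfolding transv_def form_simps conj_minus conj_divide assms(2) b'_def[symmetric]
    by (simp add: field_simps)
qed

text \<open>With \<open>e = \<delta> * \<sigma> b\<close> the hypothesis reads
  \<open>B u u = b + e\<close>, which is symmetric in \<open>b\<close> and \<open>e\<close>. The two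
  parameters therefore give mutually inverse maps.\<close>

lemma transv_inverse:
  assumes "b \<noteq> 0" "B u u = b + \<delta> * \<sigma> b"
  shows "transv u b (transv u (\<delta> * \<sigma> b) v) = v"
proof -
  define e where "e = \<delta> * \<sigma> b"
  have e: "e \<noteq> 0" "B u u = b + e"
    using assms by (auto simp: e_def)
  have "B (transv u e v) u = - (B v u * b / e)"
    using e by (simp add: transv_def form_simps field_simps)
  then have "transv u b (transv u e v) = vadd (transv u e v) (vscale (B v u / e) u)"
    using assms(1) by (simp add: transv_def[of u b])
  then show ?thesis
    by (simp add: transv_def vadd_def vscale_def e_def[symmetric])
qed

lemma transv_bij:
  assumes "b \<noteq> 0" "B u u = b + \<delta> * \<sigma> b"
  shows "bij (transv u b)"
proof (rule o_bij)
  show "transv u b \<circ> transv u (\<delta> * \<sigma> b) = id"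
    using transv_inverse[OF assms] by auto
  show "transv u (\<delta> * \<sigma> b) \<circ> transv u b = id"
    using transv_inverse[of "\<delta> * \<sigma> b" u] assms by (auto simp: conj_mult conj_conj algebra_simps)
qed

lemma transv_in_isometries:
  assumes "b \<noteq> 0" "B u u = b + \<delta> * \<sigma> b" "\<And>i. d \<le> i \<Longrightarrow> u i = 0"
  shows "transv u b \<in> isometries d B"
proof -
  have "linear_map (transv u b)"
    by (simp add: linear_map_def transv_def form_simps)
      (simp add: vadd_def vscale_def fun_eq_iff algebra_simps add_divide_distrib)
  then show ?thesis
    using assms transv_isometry[OF assms(1,2)] transv_bij[OF assms(1,2)]
    by (auto simp: isometries_def transv_def vadd_def vscale_def zero_left)
qed

end

section \<open>Moving vectors by the stabiliser of a bounding pair\<close>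

locale form_with_pair = hermitian_form +
  fixes g' :: "(nat \<Rightarrow> 'a) \<Rightarrow> (nat \<Rightarrow> 'a)" and V' :: "(nat \<Rightarrow> 'a) set"
  assumes g': "g' \<in> isometries d B"
    and g'_fixes: "v \<in> V' \<Longrightarrow> g' v = v"
    and subspace: "is_subspace V'"
begin

definition stab :: "((nat \<Rightarrow> 'a) \<Rightarrow> (nat \<Rightarrow> 'a)) set" where
  "stab = {s \<in> isometries d B. s \<circ> g' = g' \<circ> s \<and> s ` V' = V'}"

lemma stab_comp:
  assumes "s \<in> stab" "t \<in> stab"
  shows "s \<circ> t \<in> stab"
proof -
  have "(s \<circ> t) \<circ> g' = g' \<circ> (s \<circ> t)"
    using assms by (simp add: stab_def comp_assoc) (simp add: comp_assoc[symmetric])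
  moreover have "(s \<circ> t) ` V' = V'"
    using assms by (simp only: stab_def mem_Collect_eq image_comp[symmetric])
  ultimately show ?thesis
    using assms isometries_comp by (auto simp: stab_def)
qed

lemma V'_closed: "x \<in> V' \<Longrightarrow> y \<in> V' \<Longrightarrow> vadd x y \<in> V'" "x \<in> V' \<Longrightarrow> vscale a x \<in> V'"
  using subspace by (auto simp: is_subspace_def)

lemma transv_in_stab:
  assumes "b \<noteq> 0" "B u u = b + \<delta> * \<sigma> b" "\<And>i. d \<le> i \<Longrightarrow> u i = 0" "u \<in> V'"
  shows "transv u b \<in> stab"
proof -
  have "B (g' v) u = B v u" for v
    using isometriesD(6)[OF g', of v u] g'_fixes[OF assms(4)] by simp
  then have "transv u b \<circ> g' = g' \<circ> transv u b"
    using g'_fixes[OF assms(4)] by (auto simp: transv_def isometriesD[OF g'])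
  moreover have "transv u b ` V' = V'"
  proof -
    \<comment> \<open>Closure holds for every parameter \<open>c\<close>, so it covers the inverse
      transvection too, and this turns the inclusion into an equality.\<close>
    have closed: "transv u c v \<in> V'" if "v \<in> V'" for c v
      using assms(4) that by (simp add: transv_def V'_closed)
    then have "v \<in> transv u b ` V'" if "v \<in> V'" for v
      using that transv_inverse[OF assms(1,2), of v] by (metis imageI)
    with closed show ?thesis
      by blast
  qed
  ultimately show ?thesis
    using transv_in_isometries[OF assms(1-3)] by (simp add: stab_def)
qed

text \<open>One transvection along \<open>f - e\<close> does this. It fixes everything orthogonal to
  \<open>f - e\<close>, which allows a second basis vector to be moved without disturbing the
  first.\<close>

lemma stab_move:
  assumes "e \<in> V'" "f \<in> V'" "\<And>i. d \<le> i \<Longrightarrow> e i = 0" "\<And>i. d \<le> i \<Longrightarrow> f i = 0"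
    and norm: "B e e = B f f" and ne: "B f e \<noteq> B f f"
  shows "\<exists>s\<in>stab. s f = e \<and> (\<forall>z. B z e = B z f \<longrightarrow> s z = z)"
proof -
  define u where "u = vadd f (vscale (-1) e)"
  define b where "b = B f f - B f e"
  have bz: "B z u = B z f - B z e" for z
    by (simp add: u_def form_simps)
  have "b \<noteq> 0"
    using ne by (simp add: b_def)
  moreover have "B u u = b + \<delta> * \<sigma> b"
    using norm swap[of f f] swap[of e f]
    by (simp add: u_def b_def form_simps conj_add[of _ "- _", simplified] algebra_simps)
  moreover have "u \<in> V'"
    using assms by (simp add: u_def V'_closed)
  moreover have "u i = 0" if "d \<le> i" for i
    using assms that by (simp add: u_def vadd_def vscale_def)
  ultimately have "transv u b \<in> stab"
    by (intro transv_in_stab)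
  moreover have "transv u b f = e"
    using \<open>b \<noteq> 0\<close> by (simp add: transv_def bz flip: b_def) (simp add: u_def vadd_def vscale_def)
  moreover have "transv u b z = z" if "B z e = B z f" for z
    using that by (simp add: transv_def bz vadd_def vscale_def)
  ultimately show ?thesis
    by blast
qed

lemma stab_move_via:
  assumes V: "e \<in> V'" "f \<in> V'" "h \<in> V'"
    and supp: "\<And>i. d \<le> i \<Longrightarrow> e i = 0" "\<And>i. d \<le> i \<Longrightarrow> f i = 0" "\<And>i. d \<le> i \<Longrightarrow> h i = 0"
    and norm: "B e e = B f f" "B h h = B f f" and ne: "B f h \<noteq> B f f" "B h e \<noteq> B f f"
  shows "\<exists>s\<in>stab. s f = e \<and> (\<forall>z. B z e = B z h \<and> B z f = B z h \<longrightarrow> s z = z)"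
proof -
  obtain s where s: "s \<in> stab" "s f = h" "\<And>z. B z h = B z f \<Longrightarrow> s z = z"
    using stab_move[OF V(3,2) supp(3,2) norm(2) ne(1)] by auto
  obtain t where t: "t \<in> stab" "t h = e" "\<And>z. B z e = B z h \<Longrightarrow> t z = z"
    using stab_move[OF V(1,3) supp(1,3)] norm ne(2) by auto
  show ?thesis
    using s t stab_comp[OF t(1) s(1)] by (intro bexI[of _ "t \<circ> s"]) auto
qed

text \<open>The direct move fails only if \<open>B f e = B f f\<close>. Then
  \<open>h = vscale l e\<close> has the same norm as \<open>e\<close>, while \<open>B f h\<close>
  and \<open>B h e\<close> differ from \<open>B f f\<close> by the factors \<open>\<sigma> l\<close>
  and \<open>l\<close>, both different from 1; so the route through \<open>h\<close> is
  open.\<close>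

lemma stab_move_anisotropic:
  assumes V: "e \<in> V'" "f \<in> V'" and supp: "\<And>i. d \<le> i \<Longrightarrow> e i = 0" "\<And>i. d \<le> i \<Longrightarrow> f i = 0"
    and norm: "B e e = B f f" "B f f \<noteq> 0" and l: "l \<noteq> 1" "l * \<sigma> l = 1"
  shows "\<exists>s\<in>stab. s f = e \<and> (\<forall>z. B z e = 0 \<and> B z f = 0 \<longrightarrow> s z = z)"
proof (cases "B f e = B f f")
  case False
  then show ?thesis
    using stab_move[OF V supp norm(1)] by metis
next
  case True
  define h where "h = vscale l e"
  have h: "h \<in> V'" "\<And>i. d \<le> i \<Longrightarrow> h i = 0"
    using V supp by (auto simp: h_def V'_closed) (simp add: vscale_def)
  have bz: "B z h = \<sigma> l * B z e" for z
    by (simp add: h_def form_simps)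
  have "\<sigma> l \<noteq> 1"
    using l(1) conj_conj[of l] by auto
  then have fh: "B f h \<noteq> B f f"
    using True norm(2) by (simp add: bz)
  have he: "B h e \<noteq> B f f"
    using l(1) norm by (simp add: h_def scale_left)
  have "B h h = l * \<sigma> l * B e e"
    by (simp add: h_def form_simps)
  then have hh: "B h h = B f f"
    using l(2) norm(1) by simp
  show ?thesis
    using stab_move_via[OF V h(1) supp h(2) norm(1) hh fh he] by (metis bz mult_zero_right)
qed

text \<open>After \<open>x a\<close> has been moved to \<open>a\<close>, the image \<open>f\<close>
  of \<open>x b\<close> is orthogonal to \<open>a\<close>, as \<open>b\<close> is. Moving
  \<open>f\<close> to \<open>b\<close> therefore keeps \<open>a\<close> fixed.\<close>

lemma stab_move_orthogonal_pair:
  assumes x: "x \<in> isometries d B" and xV: "x a \<in> V'" "x b \<in> V'" and V: "a \<in> V'" "b \<in> V'"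
    and supp: "\<And>i. d \<le> i \<Longrightarrow> a i = 0" "\<And>i. d \<le> i \<Longrightarrow> b i = 0"
    and ab: "B a a \<noteq> 0" "B b b \<noteq> 0" "B a b = 0" and l: "l \<noteq> 1" "l * \<sigma> l = 1"
  shows "\<exists>s\<in>stab. s (x a) = a \<and> s (x b) = b"
proof -
  note xD = isometriesD[OF x]
  obtain s where s: "s \<in> stab" "s (x a) = a"
    using stab_move_anisotropic[OF V(1) xV(1) _ _ _ _ l] supp ab xD by auto
  then have sD: "s \<in> isometries d B" "s ` V' = V'"
    by (auto simp: stab_def)
  define f where "f = s (x b)"
  have "B a f = 0"
    using isometriesD(6)[OF sD(1), of "x a" "x b"] s(2) xD ab by (simp add: f_def)
  moreover have "f \<in> V'" "\<And>i. d \<le> i \<Longrightarrow> f i = 0" "B f f = B b b"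
    using sD xV supp xD isometriesD[OF sD(1)] by (auto simp: f_def)
  ultimately obtain t where "t \<in> stab" "t f = b" "t a = a"
    using stab_move_anisotropic[OF V(2) _ supp(2) _ _ _ l, of f] ab by auto
  then show ?thesis
    using s stab_comp by (intro bexI[of _ "t \<circ> s"]) (auto simp: f_def)
qed

text \<open>All norms vanish here, so a move between two vectors is possible as soon as their
  pairing is nonzero. This leaves only the choice of intermediate vectors.\<close>

lemma stab_move_hyperbolic_pair:
  assumes x: "x \<in> isometries d B" and xV: "x a \<in> V'" "x b \<in> V'" and V: "a \<in> V'" "b \<in> V'"
    and supp: "\<And>i. d \<le> i \<Longrightarrow> a i = 0" "\<And>i. d \<le> i \<Longrightarrow> b i = 0"
    and alt: "\<And>v. B v v = 0" and ab: "B a b = 1"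
  shows "\<exists>s\<in>stab. s (x a) = a \<and> s (x b) = b"
proof -
  note xD = isometriesD[OF x]
  have skew: "B v w = - B w v" for v w
    using alt[of v] alt[of w] alt[of "vadd v w"]
    by (simp add: form_simps eq_neg_iff_add_eq_0 add.commute)
  have addV: "vadd v w \<in> V'" "\<And>i. d \<le> i \<Longrightarrow> vadd v w i = 0"
    if "v \<in> V'" "w \<in> V'" "\<And>i. d \<le> i \<Longrightarrow> v i = 0" "\<And>i. d \<le> i \<Longrightarrow> w i = 0" for v w
    using that by (auto simp: V'_closed) (simp add: vadd_def)
  have xab: "B (x a) (x b) = 1"
    using xD ab by simp
  have xsupp: "\<And>i. d \<le> i \<Longrightarrow> x a i = 0" "\<And>i. d \<le> i \<Longrightarrow> x b i = 0"
    using xD supp by auto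
  \<comment> \<open>One of \<open>b\<close>, \<open>x b\<close> and their sum pairs nontrivially
    with both \<open>x a\<close> and \<open>a\<close>, because \<open>B a b = 1\<close> and
    \<open>B (x a) (x b) = 1\<close>.\<close>
  obtain h where h: "h \<in> V'" "\<And>i. d \<le> i \<Longrightarrow> h i = 0" "B (x a) h \<noteq> 0" "B h a \<noteq> 0"
  proof (cases "B (x a) b = 0")
    case False
    then show ?thesis
      using V supp ab skew[of b a] by (intro that[of b]) auto
  next
    case xa_b: True
    show ?thesis
    proof (cases "B (x b) a = 0")
      case False
      then show ?thesis
        using xV xsupp xab by (intro that[of "x b"]) auto
    next
      case True
      then show ?thesis
        using xa_b xab ab skew[of b a]
        by (intro that[of "vadd b (x b)"] addV V xV supp xsupp) (simp_all add: form_simps)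
    qed
  qed
  obtain s where s: "s \<in> stab" "s (x a) = a"
    using stab_move_via[OF V(1) xV(1) h(1) supp(1) xsupp(1) h(2)] h(3,4) alt by metis
  then have sD: "s \<in> isometries d B" "s ` V' = V'"
    by (auto simp: stab_def)
  define f where "f = s (x b)"
  have af: "B a f = 1"
    using isometriesD(6)[OF sD(1), of "x a" "x b"] s(2) xab by (simp add: f_def)
  have f: "f \<in> V'" "\<And>i. d \<le> i \<Longrightarrow> f i = 0"
    using sD xV xsupp isometriesD[OF sD(1)] by (auto simp: f_def)
  obtain t where "t \<in> stab" "t f = b" "t a = a"
  proof (cases "B f b = 0")
    case False
    then show ?thesis
      using stab_move[OF V(2) f(1) supp(2) f(2)] that ab af alt by metis
  next
    case True
    \<comment> \<open>The detour through \<open>b + a\<close> keeps \<open>a\<close> fixed: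
      \<open>a\<close> pairs to 1 with each of \<open>f\<close>, \<open>b + a\<close> and
      \<open>b\<close>.\<close>
    have ab': "B a (vadd b a) = 1"
      by (simp add: form_simps ab alt)
    have "B f (vadd b a) \<noteq> 0" "B (vadd b a) b \<noteq> 0"
      using True af ab skew[of f a] by (auto simp: form_simps alt)
    with ab' show ?thesis
      using stab_move_via[OF V(2) f(1) addV(1)[OF V(2,1) supp(2,1)] supp(2) f(2) addV(2)[OF V(2,1) supp(2,1)]]
        that ab af alt by metis
  qed
  then show ?thesis
    using s stab_comp by (intro bexI[of _ "t \<circ> s"]) (auto simp: f_def)
qed

end

section \<open>The standard forms\<close>

text \<open>For \<open>NegSym\<close> the formula defining \<open>formB\<close> at \<open>n = 0\<close> is that of \<open>n = 1\<close>; replacing it by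
  the zero form (which agrees with it on \<open>Vn NegSym 0\<close>) makes \<open>stdB\<close> additive in blocks.\<close>

definition stdB :: "form_case \<Rightarrow> nat \<Rightarrow> 'a::{field,finite} \<Rightarrow> nat \<Rightarrow> (nat \<Rightarrow> 'a) \<Rightarrow> (nat \<Rightarrow> 'a) \<Rightarrow> 'a" where
  "stdB c q eps n = (if c = NegSym \<and> n = 0 then (\<lambda>_ _. 0) else formB c q eps n)"

text \<open>The summand gained in passing from \<open>n\<close> to \<open>Suc n\<close>. For
  \<open>NegSym\<close>, block 0 is the plane with the form involving \<open>eps\<close>. For
  \<open>OddSym\<close>, coordinate 0 already lies in \<open>Vn OddSym 0\<close> and belongs to no
  block, hence the shifted indices.\<close>

fun blockB :: "form_case \<Rightarrow> nat \<Rightarrow> 'a::{field,finite} \<Rightarrow> nat \<Rightarrow> (nat \<Rightarrow> 'a) \<Rightarrow> (nat \<Rightarrow> 'a) \<Rightarrow> 'a" where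
  "blockB Herm q eps n x y = x n * y n ^ q"
| "blockB Alt q eps n x y = x (2*n) * y (2*n+1) - x (2*n+1) * y (2*n)"
| "blockB PosSym q eps n x y = x (2*n) * y (2*n+1) + x (2*n+1) * y (2*n)"
| "blockB NegSym q eps n x y = (if n = 0 then x 0 * y 0 - eps * x 1 * y 1
      else x (2*n) * y (2*n+1) + x (2*n+1) * y (2*n))"
| "blockB OddSym q eps n x y = x (2*n+1) * y (2*n+2) + x (2*n+2) * y (2*n+1)"

definition blockV :: "form_case \<Rightarrow> nat \<Rightarrow> (nat \<Rightarrow> 'a::field) set" where
  "blockV c n = {z. \<forall>i. z i \<noteq> 0 \<longrightarrow> dimV c n \<le> i \<and> i < dimV c (Suc n)}"

definition conj_of :: "form_case \<Rightarrow> nat \<Rightarrow> 'a::field \<Rightarrow> 'a" where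
  "conj_of c q a = (if c = Herm then a ^ q else a)"

definition sign_of :: "form_case \<Rightarrow> 'a::field" where
  "sign_of c = (if c = Alt then -1 else 1)"

definition unit_vec :: "nat \<Rightarrow> nat \<Rightarrow> 'a::field" where
  "unit_vec k = (\<lambda>i. if i = k then 1 else 0)"

lemma dimV_mono: "m \<le> n \<Longrightarrow> dimV c m \<le> dimV c n"
  by (cases c) auto

lemma stdB_Suc: "stdB c q eps (Suc n) x y = stdB c q eps n x y + blockB c q eps n x y"
  by (cases c) (auto simp: stdB_def)

lemma conj_of_simps:
  fixes a b eps :: "'a::{field,finite}"
  assumes "setting_ok c q eps"
  shows "conj_of c q (a + b) = conj_of c q a + conj_of c q b"
    and "conj_of c q (a * b) = conj_of c q a * conj_of c q b"
    and "conj_of c q (conj_of c q a) = a"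
proof -
  have card: "card (UNIV :: 'a set) = q ^ 2" if "c = Herm"
    using assms that by (simp add: setting_ok_def)
  show "conj_of c q (a + b) = conj_of c q a + conj_of c q b"
    using sqrt_card_power_add[OF card] by (simp add: conj_of_def)
  show "conj_of c q (a * b) = conj_of c q a * conj_of c q b"
    by (simp add: conj_of_def power_mult_distrib)
  show "conj_of c q (conj_of c q a) = a"
    using finite_field_power_card[of a] card
    by (auto simp: conj_of_def power2_eq_square power_mult)
qed

lemma blockB_simps:
  assumes "setting_ok c q eps"
  shows "blockB c q eps n (vadd x y) z = blockB c q eps n x z + blockB c q eps n y z"
    and "blockB c q eps n (vscale a x) z = a * blockB c q eps n x z"
    and "blockB c q eps n y x = sign_of c * conj_of c q (blockB c q eps n x y)"
proof -
  show "blockB c q eps n (vadd x y) z = blockB c q eps n x z + blockB c q eps n y z"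
    by (cases c) (simp_all add: vadd_def algebra_simps)
  show "blockB c q eps n (vscale a x) z = a * blockB c q eps n x z"
    by (cases c) (simp_all add: vscale_def algebra_simps)
  show "blockB c q eps n y x = sign_of c * conj_of c q (blockB c q eps n x y)"
  proof (cases "c = Herm")
    case True
    then show ?thesis
      using conj_of_simps(2,3)[OF assms] by (simp add: sign_of_def conj_of_def)
  qed (cases c; simp add: sign_of_def conj_of_def algebra_simps)
qed

lemma blockB_cong:
  assumes "\<And>i. dimV c n \<le> i \<Longrightarrow> i < dimV c (Suc n) \<Longrightarrow> x i = x' i"
    and "\<And>i. dimV c n \<le> i \<Longrightarrow> i < dimV c (Suc n) \<Longrightarrow> y i = y' i"
  shows "blockB c q eps n x y = blockB c q eps n x' y'"
  using assms by (cases c) auto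

text \<open>The laws of the form are proved block by block, by induction on \<open>n\<close>. At
  \<open>n = 0\<close> only \<open>OddSym\<close> has a nonzero form.\<close>

lemma hermitian_form_stdB:
  assumes "setting_ok c q eps"
  shows "hermitian_form (conj_of c q) (sign_of c) (stdB c q eps n) (dimV c n)"
proof (unfold_locales, goal_cases)
  case (5 x y z)
  show ?case
  proof (induction n)
    case 0
    then show ?case
      by (cases c) (simp_all add: stdB_def vadd_def algebra_simps)
  qed (simp add: stdB_Suc blockB_simps(1)[OF assms])
next
  case (6 a x z)
  show ?case
  proof (induction n)
    case 0
    then show ?case
      by (cases c) (simp_all add: stdB_def vscale_def algebra_simps)
  qed (simp add: stdB_Suc blockB_simps(2)[OF assms] distrib_left)
next
  case (7 y x)
  have c0: "conj_of c q (0::'a) = 0"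
    using conj_of_simps(1)[OF assms, of 0 0] by (metis add_0 add_cancel_right_right)
  show ?case
  proof (induction n)
    case 0
    then show ?case
      using c0 by (cases c) (simp_all add: stdB_def conj_of_def sign_of_def)
  next
    case (Suc n)
    then show ?case
      using blockB_simps(3)[OF assms, of n y x]
      by (simp add: stdB_Suc conj_of_simps(1)[OF assms] distrib_left)
  qed
next
  case (8 x y)
  then show ?case
  proof (induction n)
    case 0
    then show ?case
      by (cases c) (simp_all add: stdB_def)
  next
    case (Suc n)
    \<comment> \<open>Since \<open>x\<close> vanishes on the block, it may be replaced there by
      \<open>vscale 0 x\<close>; linearity then makes the block term 0.\<close>
    have "blockB c q eps n x y = blockB c q eps n (vscale 0 x) y"
      by (rule blockB_cong) (use Suc.prems in \<open>auto simp: vscale_def\<close>)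
    then show ?case
      using Suc dimV_mono[of n "Suc n" c] by (simp add: stdB_Suc blockB_simps(2)[OF assms])
  qed
qed (simp_all add: conj_of_simps[OF assms] sign_of_def)

text \<open>The difference of two vectors that agree below \<open>dimV c n\<close> pairs to zero
  with everything, by \<open>zero_left\<close>.\<close>

lemma stdB_cong:
  assumes "setting_ok c q eps" "\<And>i. i < dimV c n \<Longrightarrow> x i = x' i" "\<And>i. i < dimV c n \<Longrightarrow> y i = y' i"
  shows "stdB c q eps n x y = stdB c q eps n x' y'"
proof -
  interpret hermitian_form "conj_of c q" "sign_of c" "stdB c q eps n" "dimV c n"
    using assms(1) by (rule hermitian_form_stdB)
  have cong: "stdB c q eps n u z = stdB c q eps n u' z" if "\<And>i. i < dimV c n \<Longrightarrow> u i = u' i" for u u' z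
  proof -
    have "stdB c q eps n (vadd u (vscale (-1) u')) z = 0"
      using that by (intro zero_left) (simp add: vadd_def vscale_def)
    then show ?thesis
      by (simp add: form_simps)
  qed
  have "stdB c q eps n x y = stdB c q eps n x' y"
    by (rule cong) (rule assms(2))
  moreover have "stdB c q eps n y x' = stdB c q eps n y' x'"
    by (rule cong) (rule assms(3))
  ultimately show ?thesis
    using swap[of x' y] swap[of x' y'] by simp
qed

text \<open>The conditions in \<open>Gn\<close> speak about \<open>Vn\<close> only. Its last clause,
  splitting \<open>g x\<close> into the image of \<open>projV c n x\<close> and the untouched tail,
  carries them over to the whole function space and back.\<close>

lemma Gn_eq_isometries:
  assumes "setting_ok c q eps"
  shows "Gn c q eps n = isometries (dimV c n) (stdB c q eps n)"
proof (intro equalityI subsetI)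
  let ?d = "dimV c n"
  have form: "formB c q eps n x y = stdB c q eps n x y" if "x \<in> Vn c n" "y \<in> Vn c n" for x y
    using that by (auto simp: stdB_def Vn_def)
  have proj: "projV c n x \<in> Vn c n" for x :: "nat \<Rightarrow> 'a"
    by (simp add: projV_def Vn_def)
  fix g assume g: "g \<in> Gn c q eps n"
  have bij: "bij_betw g (Vn c n) (Vn c n)"
    and split: "\<And>x i. g x i = (if i < ?d then g (projV c n x) i else x i)"
    and add: "\<And>x y. x \<in> Vn c n \<Longrightarrow> y \<in> Vn c n \<Longrightarrow> g (vadd x y) = vadd (g x) (g y)"
    and scale: "\<And>a x. x \<in> Vn c n \<Longrightarrow> g (vscale a x) = vscale a (g x)"
    and isom: "\<And>x y. x \<in> Vn c n \<Longrightarrow> y \<in> Vn c n \<Longrightarrow> formB c q eps n (g x) (g y) = formB c q eps n x y"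
    using g unfolding Gn_def mem_Collect_eq by (blast, metis, blast, blast, blast)
  have gV: "g (projV c n x) \<in> Vn c n" for x
    using bij_betwE[OF bij] proj by blast
  have pg: "projV c n (g x) = g (projV c n x)" for x
    using gV[of x] split[of x] by (auto simp: projV_def Vn_def fun_eq_iff)
  have "linear_map g"
    unfolding linear_map_def
  proof (intro conjI allI ext)
    fix x y :: "nat \<Rightarrow> 'a" and i
    have "projV c n (vadd x y) = vadd (projV c n x) (projV c n y)"
      by (auto simp: projV_def vadd_def)
    then have "g (projV c n (vadd x y)) = vadd (g (projV c n x)) (g (projV c n y))"
      using add proj by simp
    then show "g (vadd x y) i = vadd (g x) (g y) i"
      using split[of "vadd x y" i] split[of x i] split[of y i] by (simp add: vadd_def)
  next
    fix a and x :: "nat \<Rightarrow> 'a" and i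
    have "projV c n (vscale a x) = vscale a (projV c n x)"
      by (auto simp: projV_def vscale_def)
    then have "g (projV c n (vscale a x)) = vscale a (g (projV c n x))"
      using scale proj by simp
    then show "g (vscale a x) i = vscale a (g x) i"
      using split[of "vscale a x" i] split[of x i] by (simp add: vscale_def)
  qed
  moreover have "bij g"
  proof (intro bijI injI surj_def[THEN iffD2] allI)
    fix x y assume eq: "g x = g y"
    have "g (projV c n x) = g (projV c n y)"
      using pg[of x] pg[of y] eq by simp
    then have "projV c n x = projV c n y"
      using bij_betw_imp_inj_on[OF bij] proj by (meson inj_onD)
    then have "x i = y i" if "i < ?d" for i
      using that by (auto simp: projV_def fun_eq_iff split: if_splits)
    moreover have "x i = y i" if "\<not> i < ?d" for i
      using that split[of x i] split[of y i] eq by simp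
    ultimately show "x = y"
      by blast
  next
    fix y
    obtain w where w: "w \<in> Vn c n" "g w = projV c n y"
      using bij_betw_imp_surj_on[OF bij] proj[of y] by (metis imageE)
    define x where "x = (\<lambda>i. if i < ?d then w i else y i)"
    have "projV c n x = w"
      using w(1) by (auto simp: projV_def Vn_def x_def)
    then have "g x i = y i" for i
      using split[of x i] w(2) by (simp add: projV_def x_def)
    then show "\<exists>x. y = g x"
      by (metis ext)
  qed
  moreover have "g x = x" if "\<forall>i<?d. x i = 0" for x
  proof -
    \<comment> \<open>The projection is the zero vector, written as a multiple by 0 so that
      \<open>scale\<close> yields that \<open>g\<close> sends it to zero.\<close>
    have "projV c n x = vscale 0 (projV c n x)"
      using that by (auto simp: projV_def vscale_def)
    then have "g (projV c n x) = vscale 0 (g (projV c n x))"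
      using scale[OF proj] by metis
    then have "g (projV c n x) i = 0" for i
      by (metis mult_zero_left vscale_def)
    then show ?thesis
      using split[of x] that by (auto simp: fun_eq_iff)
  qed
  moreover have "stdB c q eps n (g x) (g y) = stdB c q eps n x y" for x y
  proof -
    have "stdB c q eps n (g x) (g y) = stdB c q eps n (g (projV c n x)) (g (projV c n y))"
      by (intro stdB_cong[OF assms]) (simp_all add: split[of x] split[of y])
    also have "\<dots> = stdB c q eps n (projV c n x) (projV c n y)"
      using isom proj gV form by metis
    also have "\<dots> = stdB c q eps n x y"
      by (intro stdB_cong[OF assms]) (simp_all add: projV_def)
    finally show ?thesis .
  qed
  moreover have "g x i = x i" if "?d \<le> i" for x i
    using split[of x i] that by simp
  ultimately show "g \<in> isometries ?d (stdB c q eps n)"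
    by (auto simp: isometries_def)
next
  let ?d = "dimV c n"
  have form: "formB c q eps n x y = stdB c q eps n x y" if "x \<in> Vn c n" "y \<in> Vn c n" for x y
    using that by (auto simp: stdB_def Vn_def)
  fix g assume g: "g \<in> isometries ?d (stdB c q eps n)"
  note gD = isometriesD[OF g]
  have Vn: "g x \<in> Vn c n \<longleftrightarrow> x \<in> Vn c n" for x
    using gD(4) by (auto simp: Vn_def)
  have "bij_betw g (Vn c n) (Vn c n)"
    using gD(3) Vn unfolding bij_betw_def bij_def
    by (metis (no_types, lifting) image_subset_iff inj_on_subset subsetI subset_UNIV subset_antisym surjE imageI)
  moreover have "g x = (\<lambda>i. if i < ?d then g (projV c n x) i else x i)" for x
  proof
    fix i
    define r where "r = (\<lambda>i. if i < ?d then 0 else x i)"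
    have "x = vadd (projV c n x) r"
      by (auto simp: vadd_def projV_def r_def)
    moreover have "g r = r"
      by (rule gD(5)) (simp add: r_def)
    ultimately have "g x = vadd (g (projV c n x)) r"
      using gD(1)[of "projV c n x" r] by simp
    then show "g x i = (if i < ?d then g (projV c n x) i else x i)"
      using gD(4)[of i x] by (simp add: vadd_def r_def)
  qed
  ultimately show "g \<in> Gn c q eps n"
    using gD form Vn unfolding Gn_def by simp
qed

section \<open>Passing from one block to the previous one\<close>

lemma isometries_stdB_Suc:
  assumes "g \<in> isometries (dimV c n) (stdB c q eps n)"
  shows "g \<in> isometries (dimV c (Suc n)) (stdB c q eps (Suc n))"
proof -
  note gD = isometriesD[OF assms]
  have le: "dimV c n \<le> dimV c (Suc n)"
    by (rule dimV_mono) simp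
  have "blockB c q eps n (g x) (g y) = blockB c q eps n x y" for x y
    by (rule blockB_cong) (simp_all add: gD(4))
  then show ?thesis
    using gD le by (auto simp: isometries_def linear_map_def stdB_Suc)
qed

lemma isometries_stdB_mono:
  assumes "m \<le> n"
  shows "isometries (dimV c m) (stdB c q eps m) \<subseteq> isometries (dimV c n) (stdB c q eps n)"
  using assms by (induction rule: dec_induct) (auto intro: isometries_stdB_Suc)

lemma stdB_blockV:
  assumes "setting_ok c q eps" "z \<in> blockV c n"
  shows "stdB c q eps (Suc n) x z = blockB c q eps n x z"
proof -
  interpret hermitian_form "conj_of c q" "sign_of c" "stdB c q eps n" "dimV c n"
    using assms(1) by (rule hermitian_form_stdB)
  have "stdB c q eps n z x = 0"
    using assms(2) by (intro zero_left) (fastforce simp: blockV_def)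
  then have "stdB c q eps n x z = 0"
    using swap[of x z] by simp
  then show ?thesis
    by (simp add: stdB_Suc)
qed

lemma unit_vec_in_blockV: "dimV c n \<le> k \<Longrightarrow> k < dimV c (Suc n) \<Longrightarrow> unit_vec k \<in> blockV c n"
  by (auto simp: blockV_def unit_vec_def)

lemma nonsquare_nonzero: "setting_ok NegSym q eps \<Longrightarrow> eps \<noteq> 0"
  by (auto simp: setting_ok_def)

text \<open>Pairing with the unit vectors of the block reads off the coordinates, up to a nonzero
  factor; in block 0 of \<open>NegSym\<close> this uses \<open>eps \<noteq> 0\<close>.\<close>

lemma blockB_nondegenerate:
  assumes ok: "setting_ok c q eps"
    and eq: "\<And>z. z \<in> blockV c n \<Longrightarrow> blockB c q eps n x z = blockB c q eps n y z"
    and i: "dimV c n \<le> i" "i < dimV c (Suc n)"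
  shows "x i = y i"
proof -
  have u: "blockB c q eps n x (unit_vec k) = blockB c q eps n y (unit_vec k)"
    if "dimV c n \<le> k" "k < dimV c (Suc n)" for k
    using eq unit_vec_in_blockV that by blast
  show ?thesis
  proof (cases c)
    case Herm
    then show ?thesis
      using u[of n] i by (simp add: unit_vec_def le_less_Suc_eq)
  next
    case Alt
    then have "i = 2 * n \<or> i = 2 * n + 1"
      using i by auto
    then show ?thesis
      using Alt u[of "2 * n"] u[of "2 * n + 1"] by (auto simp: unit_vec_def)
  next
    case PosSym
    then have "i = 2 * n \<or> i = 2 * n + 1"
      using i by auto
    then show ?thesis
      using PosSym u[of "2 * n"] u[of "2 * n + 1"] by (auto simp: unit_vec_def)
  next
    case NegSym
    then have "i = 2 * n \<or> i = 2 * n + 1"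
      using i by auto
    then show ?thesis
      using NegSym u[of "2 * n"] u[of "2 * n + 1"] nonsquare_nonzero ok
      by (cases "n = 0") (auto simp: unit_vec_def)
  next
    case OddSym
    then have "i = 2 * n + 1 \<or> i = 2 * n + 2"
      using i by auto
    then show ?thesis
      using OddSym u[of "2 * n + 1"] u[of "2 * n + 2"] by (auto simp: unit_vec_def)
  qed
qed

text \<open>For \<open>z\<close> in the block, \<open>g z = z\<close> gives
  \<open>B (g x) z = B x z\<close>. As the form on the block is nondegenerate, \<open>g x\<close>
  and \<open>x\<close> have the same block coordinates.\<close>

lemma isometries_stdB_descend:
  fixes eps :: "'a::{field,finite}"
  assumes ok: "setting_ok c q eps"
    and g: "g \<in> isometries (dimV c (Suc n)) (stdB c q eps (Suc n))"
    and fixes_block: "\<And>z. z \<in> blockV c n \<Longrightarrow> g z = z"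
  shows "g \<in> isometries (dimV c n) (stdB c q eps n)"
proof -
  note gD = isometriesD[OF g]
  have coord: "g x i = x i" if "dimV c n \<le> i" for x i
  proof (cases "dimV c (Suc n) \<le> i")
    case True
    then show ?thesis by (rule gD(4))
  next
    case False
    show ?thesis
    proof (rule blockB_nondegenerate[OF ok _ that])
      fix z :: "nat \<Rightarrow> 'a" assume z: "z \<in> blockV c n"
      have "stdB c q eps (Suc n) (g x) z = stdB c q eps (Suc n) x z"
        using gD(6)[of x z] fixes_block[OF z] by simp
      then show "blockB c q eps n (g x) z = blockB c q eps n x z"
        using stdB_blockV[OF ok z] by simp
    qed (use False in simp)
  qed
  moreover have "g x = x" if "\<forall>i<dimV c n. x i = 0" for x
  proof -
    define z where "z = (\<lambda>i. if i < dimV c (Suc n) then x i else 0)"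
    define r where "r = (\<lambda>i. if i < dimV c (Suc n) then 0 else x i)"
    have "z \<in> blockV c n"
      using that by (auto simp: z_def blockV_def intro: leI)
    then have "g z = z"
      by (rule fixes_block)
    moreover have "g r = r"
      by (rule gD(5)) (simp add: r_def)
    moreover have "x = vadd z r"
      by (auto simp: vadd_def z_def r_def)
    ultimately show ?thesis
      using gD(1) by metis
  qed
  moreover have "stdB c q eps n (g x) (g y) = stdB c q eps n x y" for x y
  proof -
    have "blockB c q eps n (g x) (g y) = blockB c q eps n x y"
      by (rule blockB_cong) (simp_all add: coord)
    then show ?thesis
      using gD(6)[of x y] by (simp add: stdB_Suc)
  qed
  ultimately show ?thesis
    using gD(1-3) by (auto simp: isometries_def linear_map_def)
qed

lemma blockV_subset_Vperp:
  assumes "m \<le> n"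
  shows "blockV c n \<subseteq> (Vperp c m :: (nat \<Rightarrow> 'a::field) set)"
proof
  fix z :: "nat \<Rightarrow> 'a" assume z: "z \<in> blockV c n"
  have "{i. z i \<noteq> 0} \<subseteq> {..<dimV c (Suc n)}"
    using z by (auto simp: blockV_def)
  moreover have "z i = 0" if "i < dimV c m" for i
    using z that dimV_mono[OF assms, of c] by (fastforce simp: blockV_def)
  ultimately show "z \<in> Vperp c m"
    by (auto simp: Vperp_def Vinf_def intro: finite_subset)
qed

text \<open>Membership in \<open>Ginf\<close> provides only some level \<open>m\<close>. Each block
  from \<open>n\<close> on lies in \<open>Vperp c n\<close> and is fixed pointwise, so the level can
  be lowered to \<open>n\<close>.\<close>

lemma isometries_stdB_fixing_Vperp:
  assumes ok: "setting_ok c q eps" and g: "g \<in> isometries (dimV c m) (stdB c q eps m)"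
    and fixes_perp: "\<And>z. z \<in> Vperp c n \<Longrightarrow> g z = z"
  shows "g \<in> isometries (dimV c n) (stdB c q eps n)"
proof (cases "m \<le> n")
  case True
  then show ?thesis
    using isometries_stdB_mono g by blast
next
  case False
  then have "n \<le> m" by simp
  then show ?thesis
    using g
  proof (induction rule: dec_induct)
    case (step k)
    then show ?case
      using isometries_stdB_descend[OF ok] blockV_subset_Vperp[OF step.hyps(1), of c] fixes_perp by blast
  qed
qed

text \<open>A hyperbolic plane has the sum and the difference of its two basis vectors as orthogonal
  basis, with norms 2 and -2, nonzero as \<open>q\<close> is odd. Block 0 of \<open>NegSym\<close>
  is already diagonal, with entries 1 and \<open>- eps\<close>.\<close>

lemma blockV_orthogonal_basis:
  fixes eps :: "'a::{field,finite}"
  assumes ok: "setting_ok c q eps" and c: "c \<in> {PosSym, NegSym, OddSym}"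
  obtains a b :: "nat \<Rightarrow> 'a" where "a \<in> blockV c n" "b \<in> blockV c n"
    "blockB c q eps n a a \<noteq> 0" "blockB c q eps n b b \<noteq> 0" "blockB c q eps n a b = 0"
    "\<And>z. z \<in> blockV c n \<Longrightarrow> \<exists>s t. z = vadd (vscale s a) (vscale t b)"
proof (cases "c = NegSym \<and> n = 0")
  case True
  have "z = vadd (vscale (z 0) (unit_vec 0)) (vscale (z 1) (unit_vec 1))" if "z \<in> blockV c n" for z :: "nat \<Rightarrow> 'a"
    using that True by (fastforce simp: blockV_def vadd_def vscale_def unit_vec_def fun_eq_iff)
  then show ?thesis
    using True nonsquare_nonzero ok
    by (intro that[of "unit_vec 0" "unit_vec 1"] unit_vec_in_blockV) (auto simp: unit_vec_def)
next
  case False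
  define d where "d = dimV c n"
  have d: "dimV c (Suc n) = d + 2" "dimV c n = d"
    using c by (auto simp: d_def)
  have B: "blockB c q eps n x y = x d * y (d + 1) + x (d + 1) * y d" for x y
    using c False by (auto simp: d_def)
  have two: "(2 :: 'a) \<noteq> 0"
    using ok c by (intro two_neq_zero_of_odd_card) (auto simp: setting_ok_def)
  have half_sum: "(u + v) / 2 + (u - v) / 2 = u" for u v :: 'a
  proof -
    have "(u + v) + (u - v) = 2 * u"
      by (simp only: mult_2) (simp only: algebra_simps add_diff_cancel)
    then show ?thesis
      unfolding add_divide_distrib[symmetric] using nonzero_mult_div_cancel_left[OF two] by metis
  qed
  define a :: "nat \<Rightarrow> 'a" where "a = vadd (unit_vec d) (unit_vec (d + 1))"
  define b :: "nat \<Rightarrow> 'a" where "b = vadd (unit_vec d) (vscale (-1) (unit_vec (d + 1)))"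
  have "z = vadd (vscale ((z d + z (d + 1)) / 2) a) (vscale ((z d - z (d + 1)) / 2) b)"
    if "z \<in> blockV c n" for z
  proof
    fix i
    have "z i = 0" if "i \<noteq> d" "i \<noteq> d + 1"
      using that \<open>z \<in> blockV c n\<close> d by (fastforce simp: blockV_def)
    then show "z i = vadd (vscale ((z d + z (d + 1)) / 2) a) (vscale ((z d - z (d + 1)) / 2) b) i"
      using half_sum[of "z d" "z (d + 1)"] half_sum[of "z (d + 1)" "z d"]
      by (auto simp: a_def b_def vadd_def vscale_def unit_vec_def add.commute)
  qed
  moreover have "a \<in> blockV c n" "b \<in> blockV c n"
    using d by (auto simp: blockV_def a_def b_def vadd_def vscale_def unit_vec_def split: if_splits)
  moreover have "blockB c q eps n a a = 2" "blockB c q eps n b b = -2" "blockB c q eps n a b = 0"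
    by (simp_all add: B a_def b_def vadd_def vscale_def unit_vec_def)
  ultimately show ?thesis
    using two by (intro that[of a b]) auto
qed

text \<open>It suffices to bring a basis of the block back into place: one vector of norm 1
  (Hermitian), an orthogonal pair (symmetric) or a hyperbolic pair (alternating).\<close>

lemma exists_stab_fixing_block:
  fixes eps :: "'a::{field,finite}"
  assumes ok: "setting_ok c q eps"
    and fwp: "form_with_pair (conj_of c q) (sign_of c) (stdB c q eps (Suc n)) (dimV c (Suc n)) g' V'"
    and x: "x \<in> isometries (dimV c (Suc n)) (stdB c q eps (Suc n))"
    and xV: "x ` V = V'" and V: "blockV c n \<subseteq> V" "blockV c n \<subseteq> V'"
  shows "\<exists>s \<in> form_with_pair.stab (stdB c q eps (Suc n)) (dimV c (Suc n)) g' V'.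
    \<forall>z\<in>blockV c n. s (x z) = z"
proof -
  interpret form_with_pair "conj_of c q" "sign_of c" "stdB c q eps (Suc n)" "dimV c (Suc n)" g' V'
    by (rule fwp)
  note xD = isometriesD[OF x]
  have supp: "z i = 0" if "z \<in> blockV c n" "dimV c (Suc n) \<le> i" for z :: "nat \<Rightarrow> 'a" and i
    using that by (fastforce simp: blockV_def)
  have xV': "x z \<in> V'" if "z \<in> blockV c n" for z
    using that V xV by blast
  have span: "\<forall>z\<in>blockV c n. s (x z) = z"
    if "s \<in> stab" "s (x a) = a" "s (x b) = b"
      and ab: "\<And>z. z \<in> blockV c n \<Longrightarrow> \<exists>\<alpha> \<beta>. z = vadd (vscale \<alpha> a) (vscale \<beta> b)" for s a b
  proof
    fix z :: "nat \<Rightarrow> 'a" assume "z \<in> blockV c n"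
    then obtain \<alpha> \<beta> where z: "z = vadd (vscale \<alpha> a) (vscale \<beta> b)"
      using ab by blast
    have "s \<in> isometries (dimV c (Suc n)) (stdB c q eps (Suc n))"
      using that(1) by (simp add: stab_def)
    note sD = isometriesD[OF this]
    show "s (x z) = z"
      by (simp add: z xD(1,2) sD(1,2) that(2,3))
  qed
  note B = stdB_blockV[OF ok]
  consider "c = Herm" | "c \<in> {PosSym, NegSym, OddSym}" | "c = Alt"
    by (cases c) auto
  then show ?thesis
  proof cases
    case 1
    have card: "card (UNIV :: 'a set) = q ^ 2"
      using ok 1 by (simp add: setting_ok_def)
    obtain l :: 'a where l: "l \<noteq> 1" "l * conj_of c q l = 1"
      using exists_norm_one[OF card] 1 by (auto simp: conj_of_def)
    define a :: "nat \<Rightarrow> 'a" where "a = unit_vec n"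
    have a: "a \<in> blockV c n"
      unfolding a_def using 1 by (intro unit_vec_in_blockV) auto
    have "stdB c q eps (Suc n) a a = 1"
      unfolding B[OF a] using 1 by (simp add: a_def unit_vec_def)
    then obtain s where s: "s \<in> stab" "s (x a) = a"
      using stab_move_anisotropic[of a "x a" l] supp[OF a] xV'[OF a] V(2) a xD l by auto
    have "z = vadd (vscale (z n) a) (vscale 0 a)" if "z \<in> blockV c n" for z
      using that 1 by (fastforce simp: blockV_def a_def vadd_def vscale_def unit_vec_def fun_eq_iff)
    \<comment> \<open>The block is a line here, so \<open>span\<close> is applied with the same
      vector twice.\<close>
    then show ?thesis
      using span[OF s s(2)] s(1) by blast
  next
    case 2
    obtain a b where ab: "a \<in> blockV c n" "b \<in> blockV c n"
      "blockB c q eps n a a \<noteq> 0" "blockB c q eps n b b \<noteq> 0" "blockB c q eps n a b = 0"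
      "\<And>z. z \<in> blockV c n \<Longrightarrow> \<exists>s t. z = vadd (vscale s a) (vscale t b)"
      using blockV_orthogonal_basis[OF ok 2] by metis
    have "(2::'a) \<noteq> 0"
      using ok 2 by (intro two_neq_zero_of_odd_card) (auto simp: setting_ok_def)
    \<comment> \<open>The conjugation is trivial for symmetric forms, so -1 has norm 1, and it
      differs from 1 as 2 is nonzero.\<close>
    then have l: "(-1::'a) \<noteq> 1" "(-1) * conj_of c q (-1) = (1::'a)"
      using 2 by (auto simp: conj_of_def)
    obtain s where s: "s \<in> stab" "s (x a) = a" "s (x b) = b"
      using stab_move_orthogonal_pair[OF x xV'[OF ab(1)] xV'[OF ab(2)] _ _ supp[OF ab(1)] supp[OF ab(2)] _ _ _ l]
        ab V(2) B by auto
    then show ?thesis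
      using span[OF s ab(6)] by blast
  next
    case 3
    define a :: "nat \<Rightarrow> 'a" where "a = unit_vec (2 * n)"
    define b :: "nat \<Rightarrow> 'a" where "b = unit_vec (2 * n + 1)"
    have ab: "a \<in> blockV c n" "b \<in> blockV c n"
      unfolding a_def b_def using 3 by (auto intro!: unit_vec_in_blockV)
    have "stdB c q eps (Suc n) a b = 1"
      unfolding B[OF ab(2)] using 3 by (simp add: a_def b_def unit_vec_def)
    moreover have "stdB c q eps (Suc n) v v = 0" for v
      using 3 by (simp add: stdB_def algebra_simps)
    ultimately obtain s where s: "s \<in> stab" "s (x a) = a" "s (x b) = b"
      using stab_move_hyperbolic_pair[OF x xV'[OF ab(1)] xV'[OF ab(2)] _ _ supp[OF ab(1)] supp[OF ab(2)]]
        ab V(2) by auto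
    have "z = vadd (vscale (z (2 * n)) a) (vscale (z (2 * n + 1)) b)" if "z \<in> blockV c n" for z
    proof
      fix i
      have "z i = 0" if "i \<noteq> 2 * n" "i \<noteq> 2 * n + 1"
        using that \<open>z \<in> blockV c n\<close> 3 by (fastforce simp: blockV_def)
      then show "z i = vadd (vscale (z (2 * n)) a) (vscale (z (2 * n + 1)) b) i"
        by (auto simp: a_def b_def vadd_def vscale_def unit_vec_def)
    qed
    then show ?thesis
      using span[OF s] s(1) by blast
  qed
qed

section \<open>Descent of the conjugating element\<close>

lemma act_comp: "bij s \<Longrightarrow> bij t \<Longrightarrow> act (s \<circ> t) p = act s (act t p)"
  by (simp add: act_def o_inv_distrib comp_assoc image_comp)

lemma conj_descend:
  assumes ok: "setting_ok c q eps" and nm: "n \<le> m"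
    and p: "p \<in> BP c q eps n" and p': "p' \<in> BP c q eps n"
    and x: "x \<in> isometries (dimV c (Suc m)) (stdB c q eps (Suc m))" and act: "act x p = p'"
  shows "\<exists>y\<in>isometries (dimV c m) (stdB c q eps m). act y p = p'"
proof -
  obtain g V g' V' where eqs: "p = (g, V)" "p' = (g', V')"
    by (cases p, cases p')
  have V: "Vperp c n \<subseteq> V" "Vperp c n \<subseteq> V'"
    using p p' by (auto simp: BP_def eqs)
  have g'_fixes: "g' v = v" if "v \<in> V'" for v
    using p' that by (simp add: BP_def bounding_pair_def eqs)
  \<comment> \<open>The level \<open>k\<close> of \<open>g'\<close> is arbitrary; it is first
    brought to \<open>n\<close> by means of \<open>V'\<close> and then raised to
    \<open>Suc m\<close>, the level of \<open>x\<close>.\<close>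
  obtain k where "g' \<in> isometries (dimV c k) (stdB c q eps k)"
    using p' Gn_eq_isometries[OF ok] by (auto simp: BP_def bounding_pair_def Ginf_def eqs)
  then have "g' \<in> isometries (dimV c n) (stdB c q eps n)"
    using isometries_stdB_fixing_Vperp[OF ok] g'_fixes V(2) by blast
  then have g': "g' \<in> isometries (dimV c (Suc m)) (stdB c q eps (Suc m))"
    using isometries_stdB_mono[of n "Suc m"] nm by auto
  interpret hermitian_form "conj_of c q" "sign_of c" "stdB c q eps (Suc m)" "dimV c (Suc m)"
    using ok by (rule hermitian_form_stdB)
  interpret form_with_pair "conj_of c q" "sign_of c" "stdB c q eps (Suc m)" "dimV c (Suc m)" g' V'
    using g' g'_fixes p'
    by unfold_locales (auto simp: BP_def bounding_pair_def smooth_def eqs)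
  have block: "blockV c m \<subseteq> V" "blockV c m \<subseteq> V'"
    using V subset_trans[OF blockV_subset_Vperp[OF nm]] by blast+
  have "x ` V = V'"
    using act by (simp add: act_def eqs)
  then obtain s where s: "s \<in> stab" "\<And>z. z \<in> blockV c m \<Longrightarrow> s (x z) = z"
    using exists_stab_fixing_block[OF ok form_with_pair_axioms x _ block] by blast
  have bij: "bij s" "bij x"
    using s(1) x by (auto simp: stab_def isometries_def)
  have "s \<circ> g' = g' \<circ> s" "s ` V' = V'"
    using s(1) by (auto simp: stab_def)
  then have "act s p' = p'"
    using bij_is_surj[OF bij(1)] by (simp add: act_def eqs comp_assoc surj_iff)
  then have "act (s \<circ> x) p = p'"
    using act_comp[OF bij] act by simp
  moreover have "s \<circ> x \<in> isometries (dimV c m) (stdB c q eps m)"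
  proof (rule isometries_stdB_descend[OF ok])
    show "s \<circ> x \<in> isometries (dimV c (Suc m)) (stdB c q eps (Suc m))"
      using s(1) x by (intro isometries_comp) (simp_all add: stab_def)
  qed (simp add: s(2))
  ultimately show ?thesis
    by blast
qed

theorem theorem7p16:
  fixes c :: form_case and q n :: nat and eps :: "'a::{field,finite}"
    and p p' :: "((nat \<Rightarrow> 'a) \<Rightarrow> (nat \<Rightarrow> 'a)) \<times> (nat \<Rightarrow> 'a) set"
  assumes "setting_ok c q eps"
    and "p \<in> BP c q eps n" and "p' \<in> BP c q eps n"
  shows "conj_under (Ginf c q eps) p p' \<longleftrightarrow> conj_under (Gn c q eps n) p p'"
proof
  assume "conj_under (Gn c q eps n) p p'"
  then show "conj_under (Ginf c q eps) p p'"
    by (auto simp: conj_under_def Ginf_def)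
next
  assume "conj_under (Ginf c q eps) p p'"
  then obtain m x where x: "x \<in> isometries (dimV c m) (stdB c q eps m)" "act x p = p'"
    using Gn_eq_isometries[OF assms(1)] by (auto simp: conj_under_def Ginf_def)
  have descend: "\<exists>y\<in>isometries (dimV c n) (stdB c q eps n). act y p = p'"
    if "n \<le> k" "y \<in> isometries (dimV c k) (stdB c q eps k)" "act y p = p'" for k y
    using that
  proof (induction arbitrary: y rule: dec_induct)
    case (step k)
    then show ?case
      using conj_descend[OF assms(1) step.hyps(1) assms(2,3)] by blast
  qed blast
  \<comment> \<open>The level \<open>m\<close> of \<open>x\<close> may lie below \<open>n\<close>,
    so the descent starts from the maximum of the two.\<close>
  have "x \<in> isometries (dimV c (max m n)) (stdB c q eps (max m n))"
    using x(1) isometries_stdB_mono[of m "max m n"] by auto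
  then show "conj_under (Gn c q eps n) p p'"
    using descend[of "max m n"] x(2) Gn_eq_isometries[OF assms(1)] by (simp add: conj_under_def)
qed

end
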